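(* Let $\mathfrak{A}$ be the antenna graph. The transition group $G=\mathcal{G}(\mathfrak{A})$ is not residually finite.
   Context: The transition group $\mathcal{G}(\Gamma)$ of a connected directed graph $\Gamma$ whose edges are labeled by a finite alphabet $A$ closed under inversion, with each edge $v\xrightarrow{x}w$ having an inverse edge $w\xrightarrow{x^{-1}}v$, and with exactly one outgoing $x$-edge at every vertex for every $x\in A$, is the group of permutations of the vertex set generated by the permutations $v\mapsto v\cdot x$ ($x\in A$), where $v\cdot x$ is the endpoint of the $x$-edge at $v$ (right action). The antenna graph $\mathfrak{A}$ is the graph over $\{a^{\pm1},b^{\pm1},c^{\pm1}\}$ constructed as follows (inverse edges are always understood). Let $\Gamma$ be the $c$-line with vertices $\gamma_i$, edges $\gamma_i\xrightarrow{c}\gamma_{i+1}$ ($i\in\mathbb{Z}$), root $\gamma_0$. Let $\Lambda_a$ have vertices $\lambda_{a,i}$, edges $\lambda_{a,i}\xrightarrow{a}\lambda_{a,i+1}$ and loops $\lambda_{a,i}\xrightarrow{b}\lambda_{a,i}$ ($i\in\mathbb{Z}$), root $\lambda_{a,0}$. Let $\Lambda_b$ have vertices $\lambda_{b,i}$, edges $\lambda_{b,i}\xrightarrow{b}\lambda_{b,i+1}$ and loops $\lambda_{b,i}\xrightarrow{a}\lambda_{b,i}$ ($i\in\mathbb{Z}$), root $\lambda_{b,0}$. Start from one copy of $\Gamma$ and one copy of $\Lambda_b$ with their roots identified (this vertex is the root $\gamma$ of $\mathfrak{A}$), and iterate forever: at each vertex $\gamma_i$ of a copy of $\Gamma$ with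 $i>0$ glue a new copy of $\Lambda_a$ at its root; at each vertex $\gamma_i$ of a copy of $\Gamma$ with $i<0$ glue a new copy of $\Lambda_b$ at its root; at each non-root vertex of a copy of $\Lambda_a$ or $\Lambda_b$ glue a new copy of $\Gamma$ at its root $\gamma_0$. The resulting graph is $\mathfrak{A}$. *)

theory Defs
  imports "HOL-Algebra.Algebra"
begin

text \<open>An edge from \<open>v\<close> to \<open>w\<close> labelled \<open>x\<close> is the triple \<open>(v, x, w)\<close>.\<close>

locale transition_graph =
  fixes V :: "'v set" and A :: "'x set" and iv :: "'x \<Rightarrow> 'x" and E :: "('v \<times> 'x \<times> 'v) set"
  assumes finite_alphabet: "finite A"
    and inv_letter: "x \<in> A \<Longrightarrow> iv x \<in> A"
    and inv_inv_letter: "x \<in> A \<Longrightarrow> iv (iv x) = x"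
    and edges_in: "E \<subseteq> V \<times> A \<times> V"
    and inverse_edge: "(v, x, w) \<in> E \<Longrightarrow> (w, iv x, v) \<in> E"
    and unique_edge: "v \<in> V \<Longrightarrow> x \<in> A \<Longrightarrow> \<exists>!w. (v, x, w) \<in> E"
    and nonempty: "V \<noteq> {}"
    and connected: "v \<in> V \<Longrightarrow> w \<in> V \<Longrightarrow> (v, w) \<in> {(v, w). \<exists>x. (v, x, w) \<in> E}\<^sup>*"

definition letter_action :: "'v set \<Rightarrow> ('v \<times> 'x \<times> 'v) set \<Rightarrow> 'x \<Rightarrow> 'v \<Rightarrow> 'v" where
  "letter_action V E x = (\<lambda>v\<in>V. THE w. (v, x, w) \<in> E)"

text \<open>Permutations act on the right: in the product \<open>f \<otimes> g\<close>, \<open>f\<close> is applied first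
  (\<open>BijGroup\<close> uses the opposite order).\<close>

definition right_perm_group :: "'v set \<Rightarrow> ('v \<Rightarrow> 'v) monoid" where
  "right_perm_group V =
     \<lparr>carrier = Bij V, monoid.mult = (\<lambda>f g. compose V g f), one = (\<lambda>v\<in>V. v)\<rparr>"

definition transition_group ::
    "'v set \<Rightarrow> 'x set \<Rightarrow> ('v \<times> 'x \<times> 'v) set \<Rightarrow> ('v \<Rightarrow> 'v) monoid" where
  "transition_group V A E =
     (right_perm_group V)
       \<lparr>carrier := generate (right_perm_group V) (letter_action V E ` A)\<rparr>"

definition residually_finite :: "('g, 'm) monoid_scheme \<Rightarrow> bool" where
  "residually_finite G \<longleftrightarrow>
     (\<forall>g \<in> carrier G. g \<noteq> \<one>\<^bsub>G\<^esub> \<longrightarrow>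
        (\<exists>N. N \<lhd> G \<and> finite (rcosets\<^bsub>G\<^esub> N) \<and> g \<notin> N))"

datatype gen = GenA | GenB | GenC

datatype letter = Pos gen | Neg gen

fun inv_letter :: "letter \<Rightarrow> letter" where
  "inv_letter (Pos s) = Neg s"
| "inv_letter (Neg s) = Pos s"

text \<open>For \<open>i \<noteq> 0\<close>, \<open>Gam v i\<close> is the vertex \<open>\<gamma>\<^sub>i\<close> of the copy of \<open>\<Gamma>\<close> whose root is
  identified with \<open>v\<close>, and \<open>Lam v i\<close> is the vertex with index \<open>i\<close> of the copy of \<open>\<Lambda>\<^sub>a\<close> or
  \<open>\<Lambda>\<^sub>b\<close> whose root is identified with \<open>v\<close>.  The vertices of index \<open>0\<close> are \<open>v\<close> itself.\<close>

datatype address = Root | Gam address int | Lam address int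

definition gam :: "address \<Rightarrow> int \<Rightarrow> address" where
  "gam v i = (if i = 0 then v else Gam v i)"

definition lam :: "address \<Rightarrow> int \<Rightarrow> address" where
  "lam v i = (if i = 0 then v else Lam v i)"

datatype lam_type = LamA | LamB

text \<open>\<open>gamma_root v\<close>: \<open>v\<close> is the root of a copy of \<open>\<Gamma>\<close>;
  \<open>lambda_root t v\<close>: \<open>v\<close> is the root of a copy of \<open>\<Lambda>\<^sub>a\<close> (\<open>t = LamA\<close>) or \<open>\<Lambda>\<^sub>b\<close> (\<open>t = LamB\<close>).\<close>

inductive gamma_root :: "address \<Rightarrow> bool"
  and lambda_root :: "lam_type \<Rightarrow> address \<Rightarrow> bool" where
  gamma_start: "gamma_root Root"
| lambda_start: "lambda_root LamB Root"
| glue_lambda_a: "gamma_root v \<Longrightarrow> i > 0 \<Longrightarrow> lambda_root LamA (gam v i)"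
| glue_lambda_b: "gamma_root v \<Longrightarrow> i < 0 \<Longrightarrow> lambda_root LamB (gam v i)"
| glue_gamma: "lambda_root t v \<Longrightarrow> i \<noteq> 0 \<Longrightarrow> gamma_root (lam v i)"

definition antenna_vertices :: "address set" where
  "antenna_vertices =
     {gam v i | v i. gamma_root v} \<union> {lam v i | t v i. lambda_root t v}"

inductive_set antenna_edges :: "(address \<times> letter \<times> address) set" where
  gamma_c: "gamma_root v \<Longrightarrow> (gam v i, Pos GenC, gam v (i + 1)) \<in> antenna_edges"
| lambda_a_a: "lambda_root LamA v \<Longrightarrow> (lam v i, Pos GenA, lam v (i + 1)) \<in> antenna_edges"
| lambda_a_b: "lambda_root LamA v \<Longrightarrow> (lam v i, Pos GenB, lam v i) \<in> antenna_edges"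
| lambda_b_b: "lambda_root LamB v \<Longrightarrow> (lam v i, Pos GenB, lam v (i + 1)) \<in> antenna_edges"
| lambda_b_a: "lambda_root LamB v \<Longrightarrow> (lam v i, Pos GenA, lam v i) \<in> antenna_edges"
| inverse: "(v, x, w) \<in> antenna_edges \<Longrightarrow> (w, inv_letter x, v) \<in> antenna_edges"

abbreviation antenna_group :: "(address \<Rightarrow> address) monoid" where
  "antenna_group \<equiv> transition_group antenna_vertices (UNIV :: letter set) antenna_edges"

lemma group_right_perm_group: "group (right_perm_group V)"
proof -
  let ?B = "BijGroup V" and ?R = "right_perm_group V"
  interpret B: group ?B by (rule group_BijGroup)
  have c: "carrier ?R = carrier ?B" and o: "\<one>\<^bsub>?R\<^esub> = \<one>\<^bsub>?B\<^esub>"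
    by (simp_all add: BijGroup_def right_perm_group_def)
  have m: "f \<otimes>\<^bsub>?R\<^esub> g = g \<otimes>\<^bsub>?B\<^esub> f" if "f \<in> carrier ?B" "g \<in> carrier ?B" for f g
    using that by (simp add: BijGroup_def right_perm_group_def)
  show ?thesis
  proof (rule groupI, unfold c o)
    fix x assume x: "x \<in> carrier ?B"
    show "\<exists>y\<in>carrier ?B. y \<otimes>\<^bsub>?R\<^esub> x = \<one>\<^bsub>?B\<^esub>"
      using x m B.inv_closed B.r_inv by metis
    show "\<one>\<^bsub>?B\<^esub> \<otimes>\<^bsub>?R\<^esub> x = x" using x m by simp
    fix y assume y: "y \<in> carrier ?B"
    show xy: "x \<otimes>\<^bsub>?R\<^esub> y \<in> carrier ?B" using x y m by simp
    fix z assume z: "z \<in> carrier ?B"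
    have "y \<otimes>\<^bsub>?R\<^esub> z \<in> carrier ?B" using y z m by simp
    then show "x \<otimes>\<^bsub>?R\<^esub> y \<otimes>\<^bsub>?R\<^esub> z = x \<otimes>\<^bsub>?R\<^esub> (y \<otimes>\<^bsub>?R\<^esub> z)"
      using x y z xy m by (simp add: B.m_assoc)
  qed simp
qed

lemma (in transition_graph) letter_action_in: "v \<in> V \<Longrightarrow> x \<in> A \<Longrightarrow> (v, x, letter_action V E x v) \<in> E"
  unfolding letter_action_def using theI'[OF unique_edge] by simp

lemma (in transition_graph) letter_action_eq: "(v, x, w) \<in> E \<Longrightarrow> letter_action V E x v = w"
  using letter_action_in edges_in unique_edge by blast

lemma (in transition_graph) letter_action_Bij:
  assumes x: "x \<in> A" shows "letter_action V E x \<in> Bij V"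
proof -
  have "bij_betw (letter_action V E x) V V"
  proof (rule bij_betwI[where g = "letter_action V E (iv x)"])
    show "letter_action V E x \<in> V \<rightarrow> V" "letter_action V E (iv x) \<in> V \<rightarrow> V"
      using letter_action_in x inv_letter edges_in by blast+
    show "letter_action V E (iv x) (letter_action V E x v) = v" if "v \<in> V" for v
      using letter_action_in[OF that x] inverse_edge letter_action_eq by blast
    show "letter_action V E x (letter_action V E (iv x) v) = v" if "v \<in> V" for v
      using letter_action_in[OF that inv_letter[OF x]] inverse_edge letter_action_eq
        inv_inv_letter[OF x] by metis
  qed
  then show ?thesis by (simp add: Bij_def letter_action_def)
qed

lemma (in transition_graph) group_transition_group: "group (transition_group V A E)"
proof -
  interpret P: group "right_perm_group V" by (rule group_right_perm_group)
  have "letter_action V E ` A \<subseteq> carrier (right_perm_group V)"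
    using letter_action_Bij by (auto simp: right_perm_group_def)
  then show ?thesis
    unfolding transition_group_def by (intro P.subgroup_imp_group P.generate_is_subgroup)
qed

lemma inv_inv_letter: "inv_letter (inv_letter x) = x"
  by (cases x) auto

lemma gamma_root_iff:
  "gamma_root v \<longleftrightarrow> v = Root \<or> (\<exists>t u i. v = Lam u i \<and> lambda_root t u \<and> i \<noteq> 0)"
  by (subst gamma_root.simps) (simp add: lam_def, metis)

lemma lambda_root_iff:
  "lambda_root t v \<longleftrightarrow> v = Root \<and> t = LamB \<or>
     (\<exists>u i. v = Gam u i \<and> gamma_root u \<and> (i > 0 \<and> t = LamA \<or> i < 0 \<and> t = LamB))"
  by (subst lambda_root.simps) (simp add: gam_def cong: conj_cong, metis less_irrefl)

lemma gam_inj: "gamma_root v \<Longrightarrow> gamma_root v' \<Longrightarrow> gam v i = gam v' i' \<longleftrightarrow> v = v' \<and> i = i'"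
  by (auto simp: gam_def gamma_root_iff split: if_splits)

lemma lam_inj: "lambda_root t v \<Longrightarrow> lambda_root t' v' \<Longrightarrow> lam v i = lam v' i' \<longleftrightarrow> v = v' \<and> i = i'"
  by (auto simp: lam_def lambda_root_iff split: if_splits)

lemma lambda_root_type: "lambda_root t v \<Longrightarrow> lambda_root t' v \<Longrightarrow> t = t'"
  by (auto simp: lambda_root_iff)

lemma antenna_vertex_gamma:
  assumes "w \<in> antenna_vertices" obtains v i where "gamma_root v" "w = gam v i"
proof -
  have "\<exists>v i. gamma_root v \<and> w = gam v i" if "w = lam u j" "lambda_root t u" for t u j
  proof (cases "j = 0")
    case True
    then show ?thesis using that
      by (simp add: lam_def lambda_root_iff)
        (metis gam_def gamma_start less_irrefl)
  next
    case False
    then show ?thesis using that glue_gamma by (metis gam_def)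
  qed
  then show thesis using assms that unfolding antenna_vertices_def by blast
qed

lemma antenna_vertex_lambda:
  assumes "w \<in> antenna_vertices" obtains t v i where "lambda_root t v" "w = lam v i"
proof -
  have "\<exists>t v i. lambda_root t v \<and> w = lam v i" if "w = gam u j" "gamma_root u" for u j
  proof (cases "j = 0")
    case True
    then have "w = u" using that by (simp add: gam_def)
    then show ?thesis using that(2) lambda_start
      by (metis gamma_root_iff lam_def)
  next
    case False
    then show ?thesis using that glue_lambda_a glue_lambda_b by (metis lam_def linorder_neqE)
  qed
  then show thesis using assms that unfolding antenna_vertices_def by blast
qed

lemma antenna_edge_pos:
  "(v, Pos GenC, w) \<in> antenna_edges \<longleftrightarrow>
     (\<exists>u i. gamma_root u \<and> v = gam u i \<and> w = gam u (i + 1))"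
  "(v, Pos GenA, w) \<in> antenna_edges \<longleftrightarrow>
     (\<exists>t u i. lambda_root t u \<and> v = lam u i \<and> w = lam u (if t = LamA then i + 1 else i))"
  "(v, Pos GenB, w) \<in> antenna_edges \<longleftrightarrow>
     (\<exists>t u i. lambda_root t u \<and> v = lam u i \<and> w = lam u (if t = LamB then i + 1 else i))"
  "(v, Neg s, w) \<in> antenna_edges \<longleftrightarrow> (w, Pos s, v) \<in> antenna_edges"
proof -
  define L where "L T v w \<longleftrightarrow>
    (\<exists>t u i. lambda_root t u \<and> v = lam u i \<and> w = lam u (if t = T then i + 1 else i))" for T v w
  define C where "C v w \<longleftrightarrow> (\<exists>u i. gamma_root u \<and> v = gam u i \<and> w = gam u (i + 1))" for v w
  have LI: "L T (lam u i) (lam u (i + 1))" if "lambda_root T u" for T u i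
    unfolding L_def using that by (intro exI[of _ T] exI[of _ u] exI[of _ i]) simp
  have LI': "L T (lam u i) (lam u i)" if "lambda_root t u" "t \<noteq> T" for T t u i
    unfolding L_def using that by (intro exI[of _ t] exI[of _ u] exI[of _ i]) simp
  have key: "case x of
      Pos s \<Rightarrow> (case s of GenC \<Rightarrow> C v w | GenA \<Rightarrow> L LamA v w | GenB \<Rightarrow> L LamB v w)
    | Neg s \<Rightarrow> (case s of GenC \<Rightarrow> C w v | GenA \<Rightarrow> L LamA w v | GenB \<Rightarrow> L LamB w v)"
    if "(v, x, w) \<in> antenna_edges" for v x w
    using that
  proof induction
    case (gamma_c v i)
    then show ?case by (auto simp: C_def)
  next
    case (inverse v x w)
    then show ?case by (cases x) simp_all
  qed (simp_all add: LI LI')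
  have L_edge: "(v, Pos (if T = LamA then GenA else GenB), w) \<in> antenna_edges" if l: "L T v w" for T v w
  proof -
    obtain t u i where h: "lambda_root t u" "v = lam u i" "w = lam u (if t = T then i + 1 else i)"
      using l unfolding L_def by blast
    then show ?thesis
      using lambda_a_a lambda_a_b lambda_b_a lambda_b_b by (cases t; cases T) simp_all
  qed
  have "(v, Pos GenC, w) \<in> antenna_edges \<longleftrightarrow> C v w"
    using key[of v "Pos GenC" w] antenna_edges.gamma_c by (auto simp: C_def)
  then show "(v, Pos GenC, w) \<in> antenna_edges \<longleftrightarrow>
     (\<exists>u i. gamma_root u \<and> v = gam u i \<and> w = gam u (i + 1))" unfolding C_def .
  have "(v, Pos GenA, w) \<in> antenna_edges \<longleftrightarrow> L LamA v w"
    using key[of v "Pos GenA" w] L_edge[of LamA v w] by auto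
  then show "(v, Pos GenA, w) \<in> antenna_edges \<longleftrightarrow>
     (\<exists>t u i. lambda_root t u \<and> v = lam u i \<and> w = lam u (if t = LamA then i + 1 else i))"
    unfolding L_def .
  have "(v, Pos GenB, w) \<in> antenna_edges \<longleftrightarrow> L LamB v w"
    using key[of v "Pos GenB" w] L_edge[of LamB v w] by auto
  then show "(v, Pos GenB, w) \<in> antenna_edges \<longleftrightarrow>
     (\<exists>t u i. lambda_root t u \<and> v = lam u i \<and> w = lam u (if t = LamB then i + 1 else i))"
    unfolding L_def .
  show "(v, Neg s, w) \<in> antenna_edges \<longleftrightarrow> (w, Pos s, v) \<in> antenna_edges"
    using antenna_edges.inverse inv_letter.simps by metis
qed

lemma antenna_edge_unique:
  assumes "v \<in> antenna_vertices" shows "\<exists>!w. (v, x, w) \<in> antenna_edges"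
proof -
  obtain u i where g: "gamma_root u" "v = gam u i" using antenna_vertex_gamma[OF assms] .
  obtain t p j where l: "lambda_root t p" "v = lam p j" using antenna_vertex_lambda[OF assms] .
  have C: "(v, Pos GenC, w) \<in> antenna_edges \<longleftrightarrow> w = gam u (i + 1)" for w
  proof
    assume "(v, Pos GenC, w) \<in> antenna_edges"
    then obtain u' i' where "gamma_root u'" "v = gam u' i'" "w = gam u' (i' + 1)"
      unfolding antenna_edge_pos by blast
    then show "w = gam u (i + 1)" using g gam_inj[of u' u i' i] by simp
  next
    assume "w = gam u (i + 1)"
    then show "(v, Pos GenC, w) \<in> antenna_edges" using g antenna_edges.gamma_c by simp
  qed
  have AB: "(\<exists>t' u' i'. lambda_root t' u' \<and> v = lam u' i' \<and> w = lam u' (if t' = T then i' + 1 else i'))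
      \<longleftrightarrow> w = lam p (if t = T then j + 1 else j)" for w T
  proof
    assume "\<exists>t' u' i'. lambda_root t' u' \<and> v = lam u' i' \<and> w = lam u' (if t' = T then i' + 1 else i')"
    then obtain t' u' i' where h: "lambda_root t' u'" "v = lam u' i'"
      "w = lam u' (if t' = T then i' + 1 else i')" by blast
    then have e: "u' = p" "i' = j" using l(2) h(2) lam_inj[OF h(1) l(1), of i' j] by auto
    then have "t' = t" using h(1) l(1) lambda_root_type by blast
    then show "w = lam p (if t = T then j + 1 else j)" using h(3) e by simp
  next
    assume "w = lam p (if t = T then j + 1 else j)"
    then show "\<exists>t' u' i'. lambda_root t' u' \<and> v = lam u' i' \<and> w = lam u' (if t' = T then i' + 1 else i')"
      using l by (intro exI[of _ t] exI[of _ p] exI[of _ j]) simp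
  qed
  have A: "(v, Pos GenA, w) \<in> antenna_edges \<longleftrightarrow> w = lam p (if t = LamA then j + 1 else j)" for w
    unfolding antenna_edge_pos by (rule AB)
  have B: "(v, Pos GenB, w) \<in> antenna_edges \<longleftrightarrow> w = lam p (if t = LamB then j + 1 else j)" for w
    unfolding antenna_edge_pos by (rule AB)
  have C': "(v, Neg GenC, w) \<in> antenna_edges \<longleftrightarrow> w = gam u (i - 1)" for w
  proof
    assume "(v, Neg GenC, w) \<in> antenna_edges"
    then obtain u' i' where "gamma_root u'" "w = gam u' i'" "v = gam u' (i' + 1)"
      unfolding antenna_edge_pos by blast
    then show "w = gam u (i - 1)" using g gam_inj[of u' u "i' + 1" i] by auto
  next
    assume "w = gam u (i - 1)"
    then show "(v, Neg GenC, w) \<in> antenna_edges"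
      unfolding antenna_edge_pos using g by (intro exI[of _ u] exI[of _ "i - 1"]) simp
  qed
  have AB': "(\<exists>t' u' i'. lambda_root t' u' \<and> w = lam u' i' \<and> v = lam u' (if t' = T then i' + 1 else i'))
      \<longleftrightarrow> w = lam p (if t = T then j - 1 else j)" for w T
  proof
    assume "\<exists>t' u' i'. lambda_root t' u' \<and> w = lam u' i' \<and> v = lam u' (if t' = T then i' + 1 else i')"
    then obtain t' u' i' where h: "lambda_root t' u'" "w = lam u' i'"
      "v = lam u' (if t' = T then i' + 1 else i')" by blast
    then have e: "u' = p" "j = (if t' = T then i' + 1 else i')"
      using l(2) h(3) lam_inj[OF h(1) l(1), of "if t' = T then i' + 1 else i'" j] by auto
    then have "t' = t" using h(1) l(1) lambda_root_type by blast
    then show "w = lam p (if t = T then j - 1 else j)" using h(2) e by simp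
  next
    assume "w = lam p (if t = T then j - 1 else j)"
    then show "\<exists>t' u' i'. lambda_root t' u' \<and> w = lam u' i' \<and> v = lam u' (if t' = T then i' + 1 else i')"
      using l by (intro exI[of _ t] exI[of _ p] exI[of _ "if t = T then j - 1 else j"]) auto
  qed
  have A': "(v, Neg GenA, w) \<in> antenna_edges \<longleftrightarrow> w = lam p (if t = LamA then j - 1 else j)" for w
    unfolding antenna_edge_pos by (rule AB')
  have B': "(v, Neg GenB, w) \<in> antenna_edges \<longleftrightarrow> w = lam p (if t = LamB then j - 1 else j)" for w
    unfolding antenna_edge_pos by (rule AB')
  have "\<exists>z. \<forall>w. (v, x, w) \<in> antenna_edges \<longleftrightarrow> w = z"
  proof (cases x)
    case (Pos s)
    then show ?thesis using A B C by (cases s) (blast intro: exI)+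
  next
    case (Neg s)
    then show ?thesis using A' B' C' by (cases s) (blast intro: exI)+
  qed
  then obtain z where "\<And>w. (v, x, w) \<in> antenna_edges \<longleftrightarrow> w = z" by blast
  then show ?thesis by simp
qed

lemma antenna_edges_in: "(v, x, w) \<in> antenna_edges \<Longrightarrow> v \<in> antenna_vertices \<and> w \<in> antenna_vertices"
proof (induction rule: antenna_edges.induct)
qed (unfold antenna_vertices_def, blast+)

definition antenna_adj :: "(address \<times> address) set" where
  "antenna_adj = {(v, w). \<exists>x. (v, x, w) \<in> antenna_edges}"

lemma sym_antenna_adj: "sym antenna_adj"
  unfolding antenna_adj_def by (rule symI) (auto dest: inverse)

lemma line_connected:
  assumes s: "sym r" and step: "\<And>i::int. (f i, f (i + 1)) \<in> r\<^sup>*" shows "(f 0, f i) \<in> r\<^sup>*"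
proof (induction i rule: int_induct[where k = 0])
  case (step1 i)
  then show ?case using step rtrancl_trans by metis
next
  case (step2 i)
  have "(f i, f (i - 1)) \<in> r\<^sup>*"
    using step[of "i - 1"] symD[OF sym_rtrancl[OF s]] by simp
  then show ?case using step2 rtrancl_trans by metis
qed simp

lemma gam_connected:
  assumes "gamma_root v" shows "(v, gam v i) \<in> antenna_adj\<^sup>*"
proof -
  have "(gam v j, gam v (j + 1)) \<in> antenna_adj\<^sup>*" for j
    using gamma_c[OF assms] unfolding antenna_adj_def by blast
  then have "(gam v 0, gam v i) \<in> antenna_adj\<^sup>*"
    by (intro line_connected[of _ "gam v"] sym_antenna_adj)
  then show ?thesis by (simp add: gam_def)
qed

lemma lam_connected:
  assumes "lambda_root t v" shows "(v, lam v i) \<in> antenna_adj\<^sup>*"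
proof -
  have "(lam v j, lam v (j + 1)) \<in> antenna_adj\<^sup>*" for j
    using lambda_a_a[of v j] lambda_b_b[of v j] assms unfolding antenna_adj_def
    by (cases t) blast+
  then have "(lam v 0, lam v i) \<in> antenna_adj\<^sup>*"
    by (intro line_connected[of _ "lam v"] sym_antenna_adj)
  then show ?thesis by (simp add: lam_def)
qed

lemma roots_connected:
  "gamma_root v \<Longrightarrow> (Root, v) \<in> antenna_adj\<^sup>*"
  "lambda_root t v \<Longrightarrow> (Root, v) \<in> antenna_adj\<^sup>*"
  by (induction rule: gamma_root_lambda_root.inducts)
    (meson gam_connected lam_connected rtrancl_trans rtrancl.rtrancl_refl)+

lemma antenna_connected:
  assumes "v \<in> antenna_vertices" "w \<in> antenna_vertices" shows "(v, w) \<in> antenna_adj\<^sup>*"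
proof -
  have "(Root, u) \<in> antenna_adj\<^sup>*" if "u \<in> antenna_vertices" for u
    using antenna_vertex_gamma[OF that] roots_connected(1) gam_connected rtrancl_trans by metis
  then show ?thesis
    using assms symD[OF sym_rtrancl[OF sym_antenna_adj]] rtrancl_trans by metis
qed

lemma UNIV_letter: "(UNIV :: letter set) = Pos ` {GenA, GenB, GenC} \<union> Neg ` {GenA, GenB, GenC}"
  by (auto simp: image_iff) (metis gen.exhaust letter.exhaust)

interpretation antenna: transition_graph antenna_vertices "UNIV :: letter set" inv_letter antenna_edges
proof
  show "finite (UNIV :: letter set)" unfolding UNIV_letter by simp
  show "antenna_edges \<subseteq> antenna_vertices \<times> UNIV \<times> antenna_vertices"
    using antenna_edges_in by auto
  have "gam Root 0 \<in> antenna_vertices"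
    unfolding antenna_vertices_def using gamma_start by blast
  then show "antenna_vertices \<noteq> {}" by blast
qed (use inv_inv_letter inverse antenna_edge_unique antenna_connected in
      \<open>auto simp: antenna_adj_def\<close>)

end

theory Submission
  imports Defs
begin

text \<open>
  The obstruction is a shift inside the group.  If \<open>t\<^sup>n = 1\<close> in a finite quotient, then there
  \<open>h\<close> coincides with its conjugate \<open>t\<^sup>-\<^sup>n h t\<^sup>n\<close>, and \<open>n\<close> can be taken as large as desired.
  Hence in a residually finite group an element that commutes with \<open>t\<^sup>-\<^sup>n h t\<^sup>n\<close> for all large
  \<open>n\<close> must already commute with \<open>h\<close>
  (\<open>residually_finite_commutes_if_late_conjugates_commute\<close>).

  In the antenna group this fails for \<open>t = c\<close>, \<open>x = b\<close> and \<open>h = c a c\<^sup>-\<^sup>1\<close>.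
  Along every copy of \<open>\<Gamma>\<close>, the letter \<open>b\<close> moves only vertices of index \<open>i \<le> 0\<close>, since the
  vertices of positive index lie on lines \<open>\<Lambda>\<^sub>a\<close>, where \<open>b\<close> is a loop.  Symmetrically \<open>a\<close> moves
  only vertices of index \<open>i \<ge> 0\<close>, and conjugating by powers of \<open>c\<close> shifts this half-line to
  the right, so that \<open>c\<^sup>-\<^sup>n h c\<^sup>n\<close> with \<open>n \<ge> 2\<close> moves only vertices of index \<open>i > 0\<close>.
  Permutations with disjoint supports commute, so \<open>b\<close> commutes with all these conjugates.
  The element \<open>h\<close> itself, however, moves \<open>\<gamma>\<^sub>0\<close> in every copy of \<open>\<Gamma>\<close>, in particular the root
  of the graph, which \<open>b\<close> moves as well; the images of the root show that \<open>b h \<noteq> h b\<close>.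
\<close>

text \<open>If \<open>x\<close> and \<open>h\<close> did not commute, a finite quotient would separate \<open>x h\<close> from \<open>h x\<close>.  A
  large multiple of the order of the quotient, used as exponent, turns \<open>h\<close> into a late conjugate
  without changing its image.\<close>

lemma (in group) residually_finite_commutes_if_late_conjugates_commute:
  fixes m :: nat
  assumes rf: "residually_finite G"
    and x: "x \<in> carrier G" and h: "h \<in> carrier G" and t: "t \<in> carrier G"
    and late: "\<And>n. n \<ge> m \<Longrightarrow>
      x \<otimes> (inv t [^] n \<otimes> h \<otimes> t [^] n) = (inv t [^] n \<otimes> h \<otimes> t [^] n) \<otimes> x"
  shows "x \<otimes> h = h \<otimes> x"
proof (rule ccontr)
  assume neq: "x \<otimes> h \<noteq> h \<otimes> x"
  define g where "g = x \<otimes> h \<otimes> inv (h \<otimes> x)"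
  have g: "g \<in> carrier G" using x h by (simp add: g_def)
  have "g \<noteq> \<one>"
    unfolding g_def using neq x h inv_equality[of "x \<otimes> h" "inv (h \<otimes> x)"]
    by (metis inv_closed inv_inv m_closed)
  then obtain N where N: "N \<lhd> G" and fin: "finite (rcosets N)" and gN: "g \<notin> N"
    using rf g unfolding residually_finite_def by blast
  interpret N: normal N G by (rule N)
  let ?Q = "G Mod N"
  define p where "p = (\<lambda>y. N #> y)"
  interpret Q: group ?Q by (rule N.factorgroup_is_group)
  \<comment> \<open>Unfolded to cosets, unit and product would escape the group rewriting rules of \<open>?Q\<close>.\<close>
  note one_FactGroup [simp del] mult_FactGroup [simp del]
  interpret p: group_hom G ?Q p
    unfolding p_def by unfold_locales (rule N.r_coset_hom_Mod)
  define n where "n = order ?Q * m"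
  have "finite (carrier ?Q)" using fin by (simp add: FactGroup_def)
  then have "order ?Q > 0" using Q.order_gt_0_iff_finite by blast
  then have nm: "n \<ge> m" by (simp add: n_def)
  have pt: "p t [^]\<^bsub>?Q\<^esub> n = \<one>\<^bsub>?Q\<^esub>"
    using t by (simp add: n_def Q.nat_pow_pow[symmetric] Q.pow_order_eq_1)
  have pti: "inv\<^bsub>?Q\<^esub> (p t) [^]\<^bsub>?Q\<^esub> n = \<one>\<^bsub>?Q\<^esub>"
    using t pt by (simp add: Q.nat_pow_inv)
  let ?h = "inv t [^] n \<otimes> h \<otimes> t [^] n"
  have ph: "p ?h = p h"
    using t h by (simp add: p.hom_nat_pow pt pti)
  have "p x \<otimes>\<^bsub>?Q\<^esub> p h = p (x \<otimes> ?h)"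
    using x h t ph by simp
  also have "\<dots> = p (?h \<otimes> x)" using late[OF nm] by simp
  also have "\<dots> = p h \<otimes>\<^bsub>?Q\<^esub> p x" using x h t ph by simp
  finally have "p (x \<otimes> h) = p (h \<otimes> x)" using x h by simp
  then have "p g = \<one>\<^bsub>?Q\<^esub>" using x h by (simp add: g_def del: p.hom_mult) simp
  then have "N #> g = N" by (simp add: p_def FactGroup_def)
  then show False using gN rcos_self[OF g N.subgroup_axioms] by blast
qed

lemma Bij_disjoint_supports_commute:
  assumes f: "f \<in> Bij V" and g: "g \<in> Bij V"
    and disjoint: "\<And>v. v \<in> V \<Longrightarrow> f v = v \<or> g v = v"
  shows "compose V g f = compose V f g"
proof -
  have f': "inj_on f V" "\<And>v. v \<in> V \<Longrightarrow> f v \<in> V"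
    and g': "inj_on g V" "\<And>v. v \<in> V \<Longrightarrow> g v \<in> V"
    using f g by (auto simp: Bij_def bij_betw_def)
  have "g (f v) = f (g v)" if v: "v \<in> V" for v
    \<comment> \<open>By injectivity a support is invariant, so \<open>v\<close> and its image are fixed by the other map.\<close>
    using disjoint[OF v] disjoint[OF f'(2)[OF v]] disjoint[OF g'(2)[OF v]] v f' g'
    by (metis inj_onD)
  then show ?thesis by (auto simp: compose_def)
qed

lemma (in transition_graph) letter_action_in_transition_group:
  "x \<in> A \<Longrightarrow> letter_action V E x \<in> carrier (transition_group V A E)"
  by (auto simp: transition_group_def intro: generate.incl)

lemma transition_group_mult:
  "f \<otimes>\<^bsub>transition_group V A E\<^esub> g = compose V g f"
  by (simp add: transition_group_def right_perm_group_def)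

lemma transition_group_mult_apply:
  "v \<in> V \<Longrightarrow> (f \<otimes>\<^bsub>transition_group V A E\<^esub> g) v = g (f v)"
  by (simp add: transition_group_mult compose_def)

lemma transition_group_one: "\<one>\<^bsub>transition_group V A E\<^esub> = (\<lambda>v\<in>V. v)"
  by (simp add: transition_group_def right_perm_group_def)

lemma (in transition_graph) transition_group_carrier_Bij:
  "carrier (transition_group V A E) \<subseteq> Bij V"
proof -
  interpret P: group "right_perm_group V" by (rule group_right_perm_group)
  have "letter_action V E ` A \<subseteq> carrier (right_perm_group V)"
    using letter_action_Bij by (auto simp: right_perm_group_def)
  from P.generate_incl[OF this] show ?thesis
    by (simp add: transition_group_def right_perm_group_def)
qed

lemma (in transition_graph) inv_letter_action:
  assumes x: "x \<in> A"
  shows "inv\<^bsub>transition_group V A E\<^esub> (letter_action V E x) = letter_action V E (iv x)"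
proof -
  interpret G: group "transition_group V A E" by (rule group_transition_group)
  have "letter_action V E x (letter_action V E (iv x) v) = v" if "v \<in> V" for v
    using letter_action_in[OF that inv_letter[OF x]] inverse_edge letter_action_eq
      inv_inv_letter[OF x] by metis
  then have "letter_action V E (iv x) \<otimes>\<^bsub>transition_group V A E\<^esub> letter_action V E x
      = \<one>\<^bsub>transition_group V A E\<^esub>"
    by (auto simp: transition_group_mult transition_group_one compose_def)
  then show ?thesis
    using x inv_letter by (intro G.inv_equality letter_action_in_transition_group)
qed

abbreviation act :: "letter \<Rightarrow> address \<Rightarrow> address" where
  "act \<equiv> letter_action antenna_vertices antenna_edges"

lemma gam_in_antenna_vertices: "gamma_root u \<Longrightarrow> gam u i \<in> antenna_vertices"
  unfolding antenna_vertices_def by blast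

lemma lambda_root_in_antenna_vertices: "lambda_root t v \<Longrightarrow> v \<in> antenna_vertices"
  unfolding antenna_vertices_def using lam_def by fastforce

lemma act_C: "gamma_root u \<Longrightarrow> act (Pos GenC) (gam u i) = gam u (i + 1)"
  by (intro antenna.letter_action_eq gamma_c)

lemma act_C_inverse: "gamma_root u \<Longrightarrow> act (Neg GenC) (gam u i) = gam u (i - 1)"
  using antenna.letter_action_eq[OF inverse[OF gamma_c[of u "i - 1"]]] by simp

lemma act_A_LamB: "lambda_root LamB v \<Longrightarrow> act (Pos GenA) v = v"
  using antenna.letter_action_eq[OF lambda_b_a[of v 0]] by (simp add: lam_def)

lemma act_B_LamA: "lambda_root LamA v \<Longrightarrow> act (Pos GenB) v = v"
  using antenna.letter_action_eq[OF lambda_a_b[of v 0]] by (simp add: lam_def)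

lemma act_A_LamA: "lambda_root LamA v \<Longrightarrow> act (Pos GenA) v = Lam v 1"
  using antenna.letter_action_eq[OF lambda_a_a[of v 0]] by (simp add: lam_def)

lemma act_B_LamB: "lambda_root LamB v \<Longrightarrow> act (Pos GenB) v = Lam v 1"
  using antenna.letter_action_eq[OF lambda_b_b[of v 0]] by (simp add: lam_def)

lemma gamma_root_Lam: "lambda_root t v \<Longrightarrow> i \<noteq> 0 \<Longrightarrow> gamma_root (Lam v i)"
  using glue_gamma by (simp add: lam_def)

lemma act_C_pow:
  assumes u: "gamma_root u"
  shows "(act (Pos GenC) [^]\<^bsub>antenna_group\<^esub> (n::nat)) (gam u i) = gam u (i + int n)"
    and "(act (Neg GenC) [^]\<^bsub>antenna_group\<^esub> (n::nat)) (gam u i) = gam u (i - int n)"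
proof -
  interpret G: group antenna_group by (rule antenna.group_transition_group)
  note [simp] = transition_group_mult_apply transition_group_one gam_in_antenna_vertices[OF u]
  show "(act (Pos GenC) [^]\<^bsub>antenna_group\<^esub> n) (gam u i) = gam u (i + int n)"
    by (induction n) (simp_all add: act_C[OF u] algebra_simps)
  show "(act (Neg GenC) [^]\<^bsub>antenna_group\<^esub> n) (gam u i) = gam u (i - int n)"
    by (induction n) (simp_all add: act_C_inverse[OF u] algebra_simps)
qed

definition shifted_a :: "address \<Rightarrow> address" where
  "shifted_a = act (Pos GenC) \<otimes>\<^bsub>antenna_group\<^esub> act (Pos GenA) \<otimes>\<^bsub>antenna_group\<^esub> act (Neg GenC)"

lemma letter_in_antenna_group: "act x \<in> carrier antenna_group"
  by (rule antenna.letter_action_in_transition_group) simp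

lemma shifted_a_in_antenna_group: "shifted_a \<in> carrier antenna_group"
proof -
  interpret G: group antenna_group by (rule antenna.group_transition_group)
  show ?thesis unfolding shifted_a_def by (simp add: letter_in_antenna_group)
qed

lemma shifted_a_apply:
  "gamma_root u \<Longrightarrow>
    shifted_a (gam u i) = act (Neg GenC) (act (Pos GenA) (gam u (i + 1)))"
  by (simp add: shifted_a_def transition_group_mult_apply gam_in_antenna_vertices act_C)

lemma shifted_a_fixes:
  assumes u: "gamma_root u" and i: "i + 1 < 0"
  shows "shifted_a (gam u i) = gam u i"
  using act_A_LamB[OF glue_lambda_b[OF u i]] by (simp add: shifted_a_apply[OF u] act_C_inverse[OF u])

text \<open>At \<open>\<gamma>\<^sub>0\<close> the element steps to \<open>\<gamma>\<^sub>1\<close>, leaves along the line \<open>\<Lambda>\<^sub>a\<close> glued there, and ends on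
  the copy of \<open>\<Gamma>\<close> attached to its first non-root vertex.\<close>

lemma shifted_a_gamma_root:
  assumes u: "gamma_root u"
  shows "shifted_a u = Gam (Lam (Gam u 1) 1) (- 1)"
proof -
  have l: "lambda_root LamA (Gam u 1)" using glue_lambda_a[OF u, of 1] by (simp add: gam_def)
  show ?thesis
    using shifted_a_apply[OF u, of 0] act_A_LamA[OF l] act_C_inverse[OF gamma_root_Lam[OF l], of 1 0]
    by (simp add: gam_def)
qed

text \<open>Vertices of positive index are loops for \<open>b\<close>; those of index \<open>i \<le> 0\<close> are carried by
  \<open>c\<^sup>-\<^sup>n\<close>, \<open>n \<ge> 2\<close>, deep enough into the negative side to be fixed by \<open>c a c\<^sup>-\<^sup>1\<close>.\<close>

lemma b_commutes_with_late_conjugates: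
  fixes n :: nat
  assumes n: "n \<ge> 2"
  defines "k \<equiv> inv\<^bsub>antenna_group\<^esub> act (Pos GenC) [^]\<^bsub>antenna_group\<^esub> n \<otimes>\<^bsub>antenna_group\<^esub> shifted_a
      \<otimes>\<^bsub>antenna_group\<^esub> act (Pos GenC) [^]\<^bsub>antenna_group\<^esub> n"
  shows "act (Pos GenB) \<otimes>\<^bsub>antenna_group\<^esub> k = k \<otimes>\<^bsub>antenna_group\<^esub> act (Pos GenB)"
proof -
  interpret G: group antenna_group by (rule antenna.group_transition_group)
  have inv_c: "inv\<^bsub>antenna_group\<^esub> act (Pos GenC) = act (Neg GenC)"
    by (simp add: antenna.inv_letter_action)
  have k: "k \<in> carrier antenna_group"
    unfolding k_def by (simp add: letter_in_antenna_group shifted_a_in_antenna_group)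
  have "act (Pos GenB) v = v \<or> k v = v" if v: "v \<in> antenna_vertices" for v
  proof -
    obtain u i where u: "gamma_root u" and vi: "v = gam u i"
      using antenna_vertex_gamma[OF v] .
    show ?thesis
    proof (cases "i > 0")
      case True
      then show ?thesis using act_B_LamA[OF glue_lambda_a[OF u]] vi by simp
    next
      case False
      then have "shifted_a (gam u (i - int n)) = gam u (i - int n)"
        using n by (intro shifted_a_fixes[OF u]) simp
      then have "k v = v"
        unfolding k_def inv_c vi
        by (simp add: transition_group_mult_apply gam_in_antenna_vertices[OF u] act_C_pow[OF u])
      then show ?thesis ..
    qed
  qed
  then show ?thesis
    using k letter_in_antenna_group antenna.transition_group_carrier_Bij
    unfolding transition_group_mult by (intro Bij_disjoint_supports_commute) auto
qed

text \<open>The root is carried to two different vertices: reading \<open>b\<close> last ends at a non-root vertex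
  of a \<open>\<Lambda>\<^sub>b\<close>, reading it first ends at a non-root vertex of a \<open>\<Gamma>\<close>.\<close>

lemma b_not_commutes_with_shifted_a:
  "act (Pos GenB) \<otimes>\<^bsub>antenna_group\<^esub> shifted_a \<noteq> shifted_a \<otimes>\<^bsub>antenna_group\<^esub> act (Pos GenB)"
proof
  assume eq: "act (Pos GenB) \<otimes>\<^bsub>antenna_group\<^esub> shifted_a
    = shifted_a \<otimes>\<^bsub>antenna_group\<^esub> act (Pos GenB)"
  have root: "Root \<in> antenna_vertices"
    by (rule lambda_root_in_antenna_vertices[OF lambda_start])
  have first: "shifted_a (act (Pos GenB) Root) = Gam (Lam (Gam (Lam Root 1) 1) 1) (- 1)"
    by (simp add: act_B_LamB[OF lambda_start] shifted_a_gamma_root gamma_root_Lam[OF lambda_start])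
  have "lambda_root LamA (Gam Root 1)"
    using glue_lambda_a[OF gamma_start, of 1] by (simp add: gam_def)
  then have "lambda_root LamB (Gam (Lam (Gam Root 1) 1) (- 1))"
    using glue_lambda_b[OF gamma_root_Lam, of LamA _ 1 "- 1"] by (simp add: gam_def)
  then have second: "act (Pos GenB) (shifted_a Root) = Lam (Gam (Lam (Gam Root 1) 1) (- 1)) 1"
    by (simp add: shifted_a_gamma_root[OF gamma_start] act_B_LamB)
  show False
    using fun_cong[OF eq, of Root] first second by (simp add: transition_group_mult_apply[OF root])
qed

theorem theorem10p3:
  shows "\<not> residually_finite antenna_group"
proof
  assume rf: "residually_finite antenna_group"
  interpret G: group antenna_group by (rule antenna.group_transition_group)
  have "act (Pos GenB) \<otimes>\<^bsub>antenna_group\<^esub> shifted_a = shifted_a \<otimes>\<^bsub>antenna_group\<^esub> act (Pos GenB)"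
    by (rule G.residually_finite_commutes_if_late_conjugates_commute
        [OF rf letter_in_antenna_group shifted_a_in_antenna_group letter_in_antenna_group
          b_commutes_with_late_conjugates])
  then show False using b_not_commutes_with_shifted_a by contradiction
qed

end
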